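(* Let $Z$ be a Zinbiel algebra over a field $\mathbb{K}$ with $Z=Z_1\oplus Z_2\oplus\cdots\oplus Z_m$, where $Z_1,\dots,Z_m$ are ideals of $Z$. Then $$Q\Gamma(Z)=Q\Gamma(Z_1)\oplus\cdots\oplus Q\Gamma(Z_m)\oplus\bigoplus_{i\neq j}C_{ij},$$ where, for $1\le i,j\le m$, $C_{ij}=\{\phi\in \mathrm{Hom}_{\mathbb{K}}(Z_i,Z_j) : \phi(Z_i)\subseteq C(Z_j),\ \phi(Z_i)=0 \text{ if } i=j\}$.
   Context: A Zinbiel algebra over a field $\mathbb{K}$ is a $\mathbb{K}$-vector space $Z$ with a bilinear product $\cdot$ satisfying $(p\cdot q)\cdot r=p\cdot(q\cdot r)+p\cdot(r\cdot q)$ for all $p,q,r\in Z$. Let $\mathrm{End}_{\mathbb{K}}(Z)$ denote the space of all $\mathbb{K}$-linear maps $Z\to Z$ and $\mathrm{Hom}_{\mathbb{K}}(Z_i,Z_j)$ the space of all $\mathbb{K}$-linear maps $Z_i\to Z_j$. The quasi-centroid of $Z$ is $Q\Gamma(Z)=\{\phi\in \mathrm{End}_{\mathbb{K}}(Z) : \phi(p)\cdot q=p\cdot\phi(q)\ \forall p,q\in Z\}$; the same definition applies to each $Z_i$, regarded as a Zinbiel algebra. For a Zinbiel algebra $A$, $C(A)=\{p\in A : p\cdot A=A\cdot p=0\}$. A linear map $Z_i\to Z_j$ (including $i=j$) is identified with the linear map $Z\to Z$ obtained by extending it by zero on $Z_k$ for all $k\ne i$; the direct sum is of subspaces of $\mathrm{End}_{\mathbb{K}}(Z)$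 under this identification. *)

theory Defs
  imports Complex_Main "HOL-Library.FuncSet" "HOL-Library.Function_Algebras"
begin

locale zinbiel_algebra = vector_space scale
  for scale :: "'k::field \<Rightarrow> 'v::ab_group_add \<Rightarrow> 'v" +
  fixes mult :: "'v \<Rightarrow> 'v \<Rightarrow> 'v"  (infixl "\<cdot>" 70)
  assumes linear_right: "Vector_Spaces.linear scale scale (\<lambda>q. p \<cdot> q)"
    and linear_left: "Vector_Spaces.linear scale scale (\<lambda>p. p \<cdot> q)"
    and zinbiel: "(p \<cdot> q) \<cdot> r = p \<cdot> (q \<cdot> r) + p \<cdot> (r \<cdot> q)"

definition zinbiel_ideal ::
  "('k::field \<Rightarrow> 'v::ab_group_add \<Rightarrow> 'v) \<Rightarrow> ('v \<Rightarrow> 'v \<Rightarrow> 'v) \<Rightarrow> 'v set \<Rightarrow> bool" where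
  "zinbiel_ideal scale mult A \<longleftrightarrow>
     module.subspace scale A \<and> (\<forall>a\<in>A. \<forall>z. mult a z \<in> A \<and> mult z a \<in> A)"

(* Internal direct sum of subspaces: every element of W is the sum of exactly one family
   x with x i in V i, and all such sums lie in W.  Families are taken in the extensional
   product, so that they are determined by their values on I. *)
definition internal_direct_sum ::
  "('k::field \<Rightarrow> 'w::ab_group_add \<Rightarrow> 'w) \<Rightarrow> 'i set \<Rightarrow> ('i \<Rightarrow> 'w set) \<Rightarrow> 'w set \<Rightarrow> bool" where
  "internal_direct_sum scale I V W \<longleftrightarrow>
     finite I \<and> (\<forall>i\<in>I. module.subspace scale (V i)) \<and>
     bij_betw (\<lambda>x. \<Sum>i\<in>I. x i) (\<Pi>\<^sub>E i\<in>I. V i) W"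

(* The pointwise structure making functions into a vector space; addition of functions
   is the one of HOL-Library.Function_Algebras. *)
definition fun_scale :: "('k \<Rightarrow> 'v \<Rightarrow> 'v) \<Rightarrow> 'k \<Rightarrow> ('a \<Rightarrow> 'v) \<Rightarrow> 'a \<Rightarrow> 'v" where
  "fun_scale scale c f = (\<lambda>x. scale c (f x))"

(* Linear maps between subspaces A and B.  As a HOL function such a map has the irrelevant
   value undefined outside A; for A = UNIV this is no constraint. *)
definition hom_space ::
  "('k::field \<Rightarrow> 'v::ab_group_add \<Rightarrow> 'v) \<Rightarrow> 'v set \<Rightarrow> 'v set \<Rightarrow> ('v \<Rightarrow> 'v) set" where
  "hom_space scale A B = {\<phi> \<in> A \<rightarrow>\<^sub>E B.
     (\<forall>x\<in>A. \<forall>y\<in>A. \<phi> (x + y) = \<phi> x + \<phi> y) \<and> (\<forall>c. \<forall>x\<in>A. \<phi> (scale c x) = scale c (\<phi> x))}"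

definition quasi_centroid ::
  "('k::field \<Rightarrow> 'v::ab_group_add \<Rightarrow> 'v) \<Rightarrow> ('v \<Rightarrow> 'v \<Rightarrow> 'v) \<Rightarrow> 'v set \<Rightarrow> ('v \<Rightarrow> 'v) set" where
  "quasi_centroid scale mult A =
     {\<phi> \<in> hom_space scale A A. \<forall>p\<in>A. \<forall>q\<in>A. mult (\<phi> p) q = mult p (\<phi> q)}"

definition center :: "('v::ab_group_add \<Rightarrow> 'v \<Rightarrow> 'v) \<Rightarrow> 'v set \<Rightarrow> 'v set" where
  "center mult A = {p \<in> A. \<forall>q\<in>A. mult p q = 0 \<and> mult q p = 0}"

definition center_hom ::
  "('k::field \<Rightarrow> 'v::ab_group_add \<Rightarrow> 'v) \<Rightarrow> ('v \<Rightarrow> 'v \<Rightarrow> 'v) \<Rightarrow> ('i \<Rightarrow> 'v set) \<Rightarrow> 'i \<Rightarrow> 'i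
    \<Rightarrow> ('v \<Rightarrow> 'v) set" where
  "center_hom scale mult Z i j = {\<phi> \<in> hom_space scale (Z i) (Z j).
     \<phi> ` Z i \<subseteq> center mult (Z j) \<and> (i = j \<longrightarrow> (\<forall>x\<in>Z i. \<phi> x = 0))}"

definition component :: "'i set \<Rightarrow> ('i \<Rightarrow> 'v::ab_group_add set) \<Rightarrow> 'i \<Rightarrow> 'v \<Rightarrow> 'v" where
  "component I Z i z = (THE x. x \<in> (\<Pi>\<^sub>E k\<in>I. Z k) \<and> (\<Sum>k\<in>I. x k) = z) i"

(* For UNIV the internal direct sum of the Z k and \<phi> linear on Z i: the linear map on the whole
   space that agrees with \<phi> on Z i and vanishes on Z k for all k in I different from i
   (see extend_by_zero_linear, extend_by_zero_same and extend_by_zero_other below). *)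
definition extend_by_zero ::
  "'i set \<Rightarrow> ('i \<Rightarrow> 'v::ab_group_add set) \<Rightarrow> 'i \<Rightarrow> ('v \<Rightarrow> 'v) \<Rightarrow> 'v \<Rightarrow> 'v" where
  "extend_by_zero I Z i \<phi> = (\<lambda>z. \<phi> (component I Z i z))"

lemma component_eq:
  assumes "internal_direct_sum scale I Z UNIV" "x \<in> (\<Pi>\<^sub>E k\<in>I. Z k)" "(\<Sum>k\<in>I. x k) = z"
  shows "component I Z i z = x i"
proof -
  have "inj_on (\<lambda>x. \<Sum>k\<in>I. x k) (\<Pi>\<^sub>E k\<in>I. Z k)"
    using assms(1) by (simp add: internal_direct_sum_def bij_betw_def)
  then have "(THE x. x \<in> (\<Pi>\<^sub>E k\<in>I. Z k) \<and> (\<Sum>k\<in>I. x k) = z) = x"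
    using assms(2,3) by (intro the_equality) (auto dest: inj_onD)
  then show ?thesis by (simp add: component_def)
qed

lemma direct_sum_obtain:
  assumes "internal_direct_sum scale I Z UNIV"
  obtains x where "x \<in> (\<Pi>\<^sub>E k\<in>I. Z k)" "(\<Sum>k\<in>I. x k) = z"
proof -
  have "z \<in> (\<lambda>x. \<Sum>k\<in>I. x k) ` (\<Pi>\<^sub>E k\<in>I. Z k)"
    using assms by (simp add: internal_direct_sum_def bij_betw_def)
  then show thesis using that by auto
qed

lemma component_of_summand:
  assumes "vector_space scale" "internal_direct_sum scale I Z UNIV" "k \<in> I" "v \<in> Z k" "i \<in> I"
  shows "component I Z i v = (if i = k then v else 0)"
proof -
  interpret vector_space scale by fact
  define x where "x = restrict (\<lambda>j. if j = k then v else 0) I"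
  have fin: "finite I" and sub: "\<forall>j\<in>I. subspace (Z j)"
    using assms(2) by (auto simp: internal_direct_sum_def)
  have "x \<in> (\<Pi>\<^sub>E j\<in>I. Z j)"
    using sub assms(4) subspace_0 by (auto simp: x_def)
  moreover have "(\<Sum>j\<in>I. x j) = v"
    using fin assms(3) by (simp add: x_def)
  ultimately have "component I Z i v = x i"
    by (rule component_eq[OF assms(2)])
  then show ?thesis using assms(5) by (simp add: x_def)
qed

lemma extend_by_zero_same:
  assumes "vector_space scale" "internal_direct_sum scale I Z UNIV" "i \<in> I" "v \<in> Z i"
  shows "extend_by_zero I Z i \<phi> v = \<phi> v"
  using component_of_summand[OF assms(1-4) assms(3)] by (simp add: extend_by_zero_def)

lemma extend_by_zero_other:
  assumes "vector_space scale" "internal_direct_sum scale I Z UNIV"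
    and "i \<in> I" "k \<in> I" "k \<noteq> i" "v \<in> Z k" "\<phi> \<in> hom_space scale (Z i) B"
  shows "extend_by_zero I Z i \<phi> v = 0"
proof -
  interpret vector_space scale by fact
  have "0 \<in> Z i"
    using assms(2,3) subspace_0 by (auto simp: internal_direct_sum_def)
  then have "\<phi> (0 + 0) = \<phi> 0 + \<phi> 0"
    using assms(7) unfolding hom_space_def by blast
  then show ?thesis
    using component_of_summand[OF assms(1,2,4,6,3)] assms(5) by (simp add: extend_by_zero_def)
qed

lemma extend_by_zero_linear:
  assumes "vector_space scale" "internal_direct_sum scale I Z UNIV"
    and "i \<in> I" "\<phi> \<in> hom_space scale (Z i) B"
  shows "Vector_Spaces.linear scale scale (extend_by_zero I Z i \<phi>)"
proof -
  interpret vector_space scale by fact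
  have sub: "\<forall>j\<in>I. subspace (Z j)"
    using assms(2) by (auto simp: internal_direct_sum_def)
  have mem: "component I Z i z \<in> Z i" for z
  proof -
    obtain x where x: "x \<in> (\<Pi>\<^sub>E k\<in>I. Z k)" "(\<Sum>k\<in>I. x k) = z"
      by (rule direct_sum_obtain[OF assms(2)])
    then show ?thesis using component_eq[OF assms(2) x, of i] assms(3) by auto
  qed
  have add: "component I Z i (z + w) = component I Z i z + component I Z i w" for z w
  proof -
    obtain x where x: "x \<in> (\<Pi>\<^sub>E k\<in>I. Z k)" "(\<Sum>k\<in>I. x k) = z"
      by (rule direct_sum_obtain[OF assms(2)])
    obtain y where y: "y \<in> (\<Pi>\<^sub>E k\<in>I. Z k)" "(\<Sum>k\<in>I. y k) = w"
      by (rule direct_sum_obtain[OF assms(2)])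
    have "restrict (\<lambda>k. x k + y k) I \<in> (\<Pi>\<^sub>E k\<in>I. Z k)"
      using sub x(1) y(1) by (auto intro!: subspace_add)
    moreover have "(\<Sum>k\<in>I. restrict (\<lambda>k. x k + y k) I k) = z + w"
      using x(2) y(2) by (simp add: sum.distrib)
    ultimately have "component I Z i (z + w) = restrict (\<lambda>k. x k + y k) I i"
      by (rule component_eq[OF assms(2)])
    then show ?thesis
      using component_eq[OF assms(2) x, of i] component_eq[OF assms(2) y, of i] assms(3) by simp
  qed
  have scl: "component I Z i (scale c z) = scale c (component I Z i z)" for c z
  proof -
    obtain x where x: "x \<in> (\<Pi>\<^sub>E k\<in>I. Z k)" "(\<Sum>k\<in>I. x k) = z"
      by (rule direct_sum_obtain[OF assms(2)])
    have "restrict (\<lambda>k. scale c (x k)) I \<in> (\<Pi>\<^sub>E k\<in>I. Z k)"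
      using sub x(1) by (auto intro!: subspace_scale)
    moreover have "(\<Sum>k\<in>I. restrict (\<lambda>k. scale c (x k)) I k) = scale c z"
      using x(2) by (simp flip: scale_sum_right)
    ultimately have "component I Z i (scale c z) = restrict (\<lambda>k. scale c (x k)) I i"
      by (rule component_eq[OF assms(2)])
    then show ?thesis using component_eq[OF assms(2) x, of i] assms(3) by simp
  qed
  show ?thesis
    using assms(4) mem
    by unfold_locales (auto simp: extend_by_zero_def add scl hom_space_def)
qed

end

theory Submission imports Defs begin

text \<open>
  Let \<open>\<pi>\<^sub>i\<close> be the projections of the decomposition. Distinct summands annihilate each other, so
  \<open>a \<cdot> q = a \<cdot> \<pi>\<^sub>i q\<close> for \<open>a\<close> in \<open>Z\<^sub>i\<close>. For \<open>\<phi>\<close> in the quasi-centroid and \<open>p \<in> Z\<^sub>i\<close>, \<open>q \<in> Z\<^sub>j\<close> with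
  \<open>i \<noteq> j\<close>, the element \<open>\<phi> p \<cdot> q = p \<cdot> \<phi> q\<close> lies in \<open>Z\<^sub>i \<inter> Z\<^sub>j = 0\<close>. Hence each map
  \<open>\<phi> \<mapsto> \<pi>\<^sub>j \<circ> \<phi> \<circ> \<pi>\<^sub>i\<close> preserves the quasi-centroid. These maps are orthogonal idempotents with sum the
  identity, and their images are the summands of the theorem.
\<close>

section \<open>Vector spaces of functions and a criterion for internal direct sums\<close>

lemma sum_fun_apply: "(\<Sum>a\<in>A. f a) x = (\<Sum>a\<in>A. f a x)"
  by (induction A rule: infinite_finite_induct) auto

lemma vector_space_fun_scale:
  assumes "vector_space scale"
  shows "vector_space (fun_scale scale)"
proof -
  interpret vector_space scale by fact
  show ?thesis
    by unfold_locales (auto simp: fun_scale_def fun_eq_iff algebra_simps)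
qed

text \<open>The maps \<open>P i\<close> read off the coordinates, so sending \<open>w\<close> to the
  family \<open>P i w\<close>, restricted to \<open>I\<close>, is a two-sided inverse of
  summation.\<close>

lemma internal_direct_sum_by_projections:
  assumes "finite I"
    and "\<And>i. i \<in> I \<Longrightarrow> module.subspace scale (V i)"
    and "\<And>i w. i \<in> I \<Longrightarrow> w \<in> W \<Longrightarrow> P i w \<in> V i"
    and "\<And>w. w \<in> W \<Longrightarrow> (\<Sum>i\<in>I. P i w) = w"
    and "\<And>x. x \<in> (\<Pi>\<^sub>E i\<in>I. V i) \<Longrightarrow> (\<Sum>i\<in>I. x i) \<in> W"
    and "\<And>x i. x \<in> (\<Pi>\<^sub>E i\<in>I. V i) \<Longrightarrow> i \<in> I \<Longrightarrow> P i (\<Sum>j\<in>I. x j) = x i"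
  shows "internal_direct_sum scale I V W"
proof -
  have "bij_betw (\<lambda>x. \<Sum>i\<in>I. x i) (\<Pi>\<^sub>E i\<in>I. V i) W"
  proof (rule bij_betw_byWitness[where f' = "\<lambda>w. restrict (\<lambda>i. P i w) I"])
    show "\<forall>x\<in>\<Pi>\<^sub>E i\<in>I. V i. restrict (\<lambda>i. P i (\<Sum>j\<in>I. x j)) I = x"
    proof
      fix x assume x: "x \<in> (\<Pi>\<^sub>E i\<in>I. V i)"
      show "restrict (\<lambda>i. P i (\<Sum>j\<in>I. x j)) I = x"
      proof
        fix i show "restrict (\<lambda>i. P i (\<Sum>j\<in>I. x j)) I i = x i"
          using assms(6)[OF x, of i] PiE_arb[OF x, of i] by (cases "i \<in> I") auto
      qed
    qed
    show "\<forall>w\<in>W. (\<Sum>i\<in>I. restrict (\<lambda>i. P i w) I i) = w"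
      using assms(4) by simp
    show "(\<lambda>x. \<Sum>i\<in>I. x i) ` (\<Pi>\<^sub>E i\<in>I. V i) \<subseteq> W"
      using assms(5) by blast
    show "(\<lambda>w. restrict (\<lambda>i. P i w) I) ` W \<subseteq> (\<Pi>\<^sub>E i\<in>I. V i)"
      using assms(3) by auto
  qed
  then show ?thesis
    using assms(1,2) by (simp add: internal_direct_sum_def)
qed

lemma internal_direct_sum_cong:
  assumes "\<And>i. i \<in> I \<Longrightarrow> V i = V' i"
  shows "internal_direct_sum scale I V W \<longleftrightarrow> internal_direct_sum scale I V' W"
  using assms PiE_cong[of I V V'] by (simp add: internal_direct_sum_def)

lemma hom_space_UNIV_iff:
  assumes "vector_space scale"
  shows "\<phi> \<in> hom_space scale UNIV UNIV \<longleftrightarrow> Vector_Spaces.linear scale scale \<phi>"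
proof -
  interpret vector_space scale by fact
  show ?thesis
    by (auto simp: hom_space_def Vector_Spaces.linear_iff assms)
qed

section \<open>Projections of the decomposition\<close>

locale zinbiel_ideal_decomposition = zinbiel_algebra scale mult
  for scale :: "'k::field \<Rightarrow> 'v::ab_group_add \<Rightarrow> 'v" and mult (infixl "\<cdot>" 70) +
  fixes I :: "'i set" and Z :: "'i \<Rightarrow> 'v set"
  assumes ideal: "i \<in> I \<Longrightarrow> zinbiel_ideal scale mult (Z i)"
    and direct_sum: "internal_direct_sum scale I Z UNIV"
begin

abbreviation pr :: "'i \<Rightarrow> 'v \<Rightarrow> 'v"
  where "pr \<equiv> component I Z"

text \<open>The entry of \<phi>, seen as a matrix over the decomposition, with source
  \<open>i\<close> and target \<open>j\<close>, kept as an endomorphism of the whole space so that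
  entries can be added and composed there.\<close>

definition block :: "'i \<Rightarrow> 'i \<Rightarrow> ('v \<Rightarrow> 'v) \<Rightarrow> 'v \<Rightarrow> 'v"
  where "block i j \<phi> = (\<lambda>z. pr j (\<phi> (pr i z)))"

lemma finite_index: "finite I"
  using direct_sum by (simp add: internal_direct_sum_def)

lemma subspace_summand: "i \<in> I \<Longrightarrow> subspace (Z i)"
  using direct_sum by (simp add: internal_direct_sum_def)

lemma pr_mem: "i \<in> I \<Longrightarrow> pr i z \<in> Z i"
proof -
  assume i: "i \<in> I"
  obtain x where x: "x \<in> (\<Pi>\<^sub>E k\<in>I. Z k)" "(\<Sum>k\<in>I. x k) = z"
    by (rule direct_sum_obtain[OF direct_sum])
  show ?thesis
    using component_eq[OF direct_sum x, of i] i x(1) by auto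
qed

lemma sum_pr: "(\<Sum>i\<in>I. pr i z) = z"
proof -
  obtain x where x: "x \<in> (\<Pi>\<^sub>E k\<in>I. Z k)" "(\<Sum>k\<in>I. x k) = z"
    by (rule direct_sum_obtain[OF direct_sum])
  show ?thesis
    using component_eq[OF direct_sum x] x(2) by simp
qed

lemma pr_summand: "k \<in> I \<Longrightarrow> v \<in> Z k \<Longrightarrow> i \<in> I \<Longrightarrow> pr i v = (if i = k then v else 0)"
  using component_of_summand[OF vector_space_axioms direct_sum] .

lemma pr_pr: "i \<in> I \<Longrightarrow> j \<in> I \<Longrightarrow> pr i (pr j z) = (if i = j then pr j z else 0)"
  using pr_summand pr_mem by blast

lemma linear_pr: "i \<in> I \<Longrightarrow> Vector_Spaces.linear scale scale (pr i)"
proof -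
  assume i: "i \<in> I"
  \<comment> \<open>The projection is the extension by zero of the identity of \<open>Z i\<close>;
    \<open>restrict\<close> supplies the value \<open>undefined\<close> that
    \<open>hom_space\<close> demands outside \<open>Z i\<close>.\<close>
  have "restrict id (Z i) \<in> hom_space scale (Z i) (Z i)"
    using subspace_summand[OF i] by (auto simp: hom_space_def subspace_add subspace_scale)
  from extend_by_zero_linear[OF vector_space_axioms direct_sum i this]
  show ?thesis
    using pr_mem[OF i] by (simp add: extend_by_zero_def)
qed

section \<open>Products and projections\<close>

lemmas mult_sum_right = module_hom.sum[OF linear_right[unfolded linear_iff_module_hom]]
  and mult_sum_left = module_hom.sum[OF linear_left[unfolded linear_iff_module_hom]]
  and mult_zero_right = module_hom.zero[OF linear_right[unfolded linear_iff_module_hom]]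
  and mult_zero_left = module_hom.zero[OF linear_left[unfolded linear_iff_module_hom]]
  and mult_add_right = module_hom.add[OF linear_right[unfolded linear_iff_module_hom]]
  and mult_add_left = module_hom.add[OF linear_left[unfolded linear_iff_module_hom]]
  and mult_scale_right = module_hom.scale[OF linear_right[unfolded linear_iff_module_hom]]
  and mult_scale_left = module_hom.scale[OF linear_left[unfolded linear_iff_module_hom]]

lemma mult_mem:
  "i \<in> I \<Longrightarrow> a \<in> Z i \<Longrightarrow> a \<cdot> z \<in> Z i" "i \<in> I \<Longrightarrow> a \<in> Z i \<Longrightarrow> z \<cdot> a \<in> Z i"
  using ideal by (auto simp: zinbiel_ideal_def)

lemma summands_disjoint:
  "i \<in> I \<Longrightarrow> j \<in> I \<Longrightarrow> i \<noteq> j \<Longrightarrow> v \<in> Z i \<Longrightarrow> v \<in> Z j \<Longrightarrow> v = 0"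
  using pr_summand[of i v i] pr_summand[of j v i] by simp

text \<open>Each factor pulls the product into its own ideal, and two distinct summands meet only in
  0.\<close>

lemma mult_summands_eq_0:
  "i \<in> I \<Longrightarrow> j \<in> I \<Longrightarrow> i \<noteq> j \<Longrightarrow> a \<in> Z i \<Longrightarrow> b \<in> Z j \<Longrightarrow> a \<cdot> b = 0"
  using summands_disjoint mult_mem by blast

lemma mult_pr_right:
  assumes "i \<in> I" "a \<in> Z i"
  shows "a \<cdot> pr i q = a \<cdot> q"
proof -
  have "a \<cdot> q = (\<Sum>j\<in>I. a \<cdot> pr j q)"
    by (simp add: sum_pr flip: mult_sum_right)
  also have "\<dots> = (\<Sum>j\<in>I. if j = i then a \<cdot> pr i q else 0)"
    using assms mult_summands_eq_0 pr_mem by (intro sum.cong) auto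
  finally show ?thesis
    using assms(1) finite_index by simp
qed

lemma mult_pr_left:
  assumes "i \<in> I" "a \<in> Z i"
  shows "pr i q \<cdot> a = q \<cdot> a"
proof -
  have "q \<cdot> a = (\<Sum>j\<in>I. pr j q \<cdot> a)"
    by (simp add: sum_pr flip: mult_sum_left)
  also have "\<dots> = (\<Sum>j\<in>I. if j = i then pr i q \<cdot> a else 0)"
    using assms mult_summands_eq_0 pr_mem by (intro sum.cong) auto
  finally show ?thesis
    using assms(1) finite_index by simp
qed

text \<open>Both sides equal \<open>pr i p \<cdot> pr i q\<close>. Being linear as well, each
  projection thus lies in the quasi-centroid itself.\<close>

lemma pr_mult_swap: "i \<in> I \<Longrightarrow> pr i p \<cdot> q = p \<cdot> pr i q"
  using mult_pr_right[of i "pr i p" q] mult_pr_left[of i "pr i q" p] pr_mem by simp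

section \<open>Blocks of quasi-centroid elements\<close>

lemma quasi_centroid_UNIV_iff:
  "\<phi> \<in> quasi_centroid scale mult UNIV \<longleftrightarrow>
     Vector_Spaces.linear scale scale \<phi> \<and> (\<forall>p q. \<phi> p \<cdot> q = p \<cdot> \<phi> q)"
  by (simp add: quasi_centroid_def hom_space_UNIV_iff[OF vector_space_axioms])

lemma quasi_centroid_swap: "\<phi> \<in> quasi_centroid scale mult UNIV \<Longrightarrow> \<phi> p \<cdot> q = p \<cdot> \<phi> q"
  by (simp add: quasi_centroid_UNIV_iff)

lemma quasi_centroid_off_diagonal:
  assumes "\<phi> \<in> quasi_centroid scale mult UNIV" "i \<in> I" "j \<in> I" "i \<noteq> j" "p \<in> Z i" "q \<in> Z j"
  shows "\<phi> p \<cdot> q = 0"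
proof -
  have "\<phi> p \<cdot> q \<in> Z j" "p \<cdot> \<phi> q \<in> Z i"
    using assms mult_mem by auto
  then show ?thesis
    using summands_disjoint[OF assms(2-4)] quasi_centroid_swap[OF assms(1)] by simp
qed

lemma linear_block:
  assumes "Vector_Spaces.linear scale scale \<phi>" "i \<in> I" "j \<in> I"
  shows "Vector_Spaces.linear scale scale (block i j \<phi>)"
  using assms(1) linear_pr[OF assms(2)] linear_pr[OF assms(3)]
  by (simp add: block_def Vector_Spaces.linear_iff)

lemma block_quasi_centroid:
  assumes "\<phi> \<in> quasi_centroid scale mult UNIV" "i \<in> I" "j \<in> I"
  shows "block i j \<phi> \<in> quasi_centroid scale mult UNIV"
proof -
  have "block i j \<phi> p \<cdot> q = p \<cdot> block i j \<phi> q" for p q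
  proof -
    have "block i j \<phi> p \<cdot> q = \<phi> (pr i p) \<cdot> pr j q"
      using assms(3) by (simp add: block_def pr_mult_swap)
    \<comment> \<open>The components \<open>i\<close> and \<open>j\<close> have changed places
      between \<open>p\<close> and \<open>q\<close>, so only for \<open>i = j\<close> is this the
      defining identity of \<phi>. For \<open>i \<noteq> j\<close> both sides vanish, the right one
      after moving \<phi> to its first factor.\<close>
    also have "\<dots> = pr j p \<cdot> \<phi> (pr i q)"
    proof (cases "i = j")
      case False
      then show ?thesis
        using quasi_centroid_off_diagonal[OF assms(1)] quasi_centroid_swap[OF assms(1)]
          assms(2,3) pr_mem by metis
    qed (simp add: quasi_centroid_swap[OF assms(1)])
    also have "\<dots> = p \<cdot> block i j \<phi> q"
      using assms(3) by (simp add: block_def pr_mult_swap)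
    finally show ?thesis .
  qed
  then show ?thesis
    using assms linear_block by (simp add: quasi_centroid_UNIV_iff)
qed

lemma sum_block:
  assumes "Vector_Spaces.linear scale scale \<phi>"
  shows "(\<Sum>i\<in>I. \<Sum>j\<in>I. block i j \<phi>) = \<phi>"
proof
  fix z
  have "(\<Sum>i\<in>I. \<phi> (pr i z)) = \<phi> z"
    using module_hom.sum[OF assms[unfolded linear_iff_module_hom], of "\<lambda>i. pr i z" I]
    by (simp add: sum_pr)
  then show "(\<Sum>i\<in>I. \<Sum>j\<in>I. block i j \<phi>) z = \<phi> z"
    by (simp add: sum_fun_apply block_def sum_pr)
qed

text \<open>Blocks inherit orthogonality from the projections on either side; linearity of \<phi>
  gives \<phi> 0 = 0 when the sources differ.\<close>

lemma block_block:
  assumes "Vector_Spaces.linear scale scale \<phi>" "i \<in> I" "j \<in> I" "k \<in> I" "l \<in> I"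
  shows "block i j (block k l \<phi>) = (if i = k \<and> j = l then block k l \<phi> else 0)"
  using assms module_hom.zero[OF assms(1)[unfolded linear_iff_module_hom]]
    module_hom.zero[OF linear_pr[unfolded linear_iff_module_hom]]
  by (auto simp: block_def fun_eq_iff pr_pr)

lemma block_sum:
  assumes "j \<in> I"
  shows "block i j (\<Sum>a\<in>A. f a) = (\<Sum>a\<in>A. block i j (f a))"
  by (simp add: block_def fun_eq_iff sum_fun_apply
      module_hom.sum[OF linear_pr[OF assms, unfolded linear_iff_module_hom]])

section \<open>Peirce decomposition of the quasi-centroid\<close>

lemma subspace_quasi_centroid:
  "module.subspace (fun_scale scale) (quasi_centroid scale mult UNIV)"
proof -
  interpret F: vector_space "fun_scale scale"
    by (rule vector_space_fun_scale) (rule vector_space_axioms)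
  show ?thesis
    by (rule F.subspaceI)
      (auto simp: quasi_centroid_UNIV_iff Vector_Spaces.linear_iff vector_space_axioms fun_scale_def algebra_simps
        mult_zero_right mult_zero_left mult_add_right mult_add_left mult_scale_right
        mult_scale_left)
qed

text \<open>For \<open>i\<close> and \<open>j\<close> in \<open>I\<close>, \<open>block i j\<close>
  is an idempotent that preserves the quasi-centroid, so its fixed points there are its image: the
  Peirce component for the orthogonal idempotents \<open>pr i\<close>.\<close>

definition peirce :: "'i \<Rightarrow> 'i \<Rightarrow> ('v \<Rightarrow> 'v) set"
  where "peirce i j = {\<psi> \<in> quasi_centroid scale mult UNIV. block i j \<psi> = \<psi>}"

lemma subspace_peirce:
  assumes "i \<in> I" "j \<in> I"
  shows "module.subspace (fun_scale scale) (peirce i j)"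
proof -
  interpret F: vector_space "fun_scale scale"
    by (rule vector_space_fun_scale) (rule vector_space_axioms)
  interpret P: module_hom scale scale "pr j"
    using linear_pr[OF assms(2)] by (simp add: linear_iff_module_hom)
  show ?thesis
    using subspace_quasi_centroid unfolding peirce_def F.subspace_def
    by (auto simp: block_def fun_eq_iff fun_scale_def P.add P.scale P.zero)
qed

lemma direct_sum_peirce:
  "internal_direct_sum (fun_scale scale) (I <+> {(i, j). i \<in> I \<and> j \<in> I \<and> i \<noteq> j})
     (case_sum (\<lambda>i. peirce i i) (\<lambda>(i, j). peirce i j)) (quasi_centroid scale mult UNIV)"
  (is "internal_direct_sum _ ?J ?V ?W")
proof -
  \<comment> \<open>\<open>D\<close> sends an index of either kind to its matrix position,
    \<open>Inl i\<close> going to the diagonal. Both kinds of summands then become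
    \<open>peirce\<close> at \<open>D a\<close>, and sums over the disjoint union become sums over
    \<open>I \<times> I\<close>.\<close>
  define D where "D = case_sum (\<lambda>i::'i. (i, i)) (\<lambda>a. a)"
  have bij: "bij_betw D ?J (I \<times> I)"
    by (rule bij_betw_byWitness[where f' = "\<lambda>(i, j). if i = j then Inl i else Inr (i, j)"])
      (auto simp: D_def)
  have D_mem: "fst (D a) \<in> I" "snd (D a) \<in> I" if "a \<in> ?J" for a
    using that by (auto simp: D_def)
  have V: "?V a = peirce (fst (D a)) (snd (D a))" for a
    by (auto simp: D_def split: sum.split)
  have fin: "finite ?J"
    using bij_betw_finite[OF bij] finite_index by simp
  interpret F: vector_space "fun_scale scale"
    by (rule vector_space_fun_scale) (rule vector_space_axioms)
  show ?thesis
  proof (rule internal_direct_sum_by_projections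
      [where P = "\<lambda>a. block (fst (D a)) (snd (D a))"])
    show "finite ?J" by (rule fin)
  next
    fix a assume "a \<in> ?J"
    then show "module.subspace (fun_scale scale) (?V a)"
      unfolding V using D_mem by (intro subspace_peirce)
  next
    fix a \<phi> assume "a \<in> ?J" and \<phi>: "\<phi> \<in> ?W"
    then show "block (fst (D a)) (snd (D a)) \<phi> \<in> ?V a"
      unfolding V unfolding peirce_def using D_mem[of a] block_quasi_centroid block_block
      by (simp add: quasi_centroid_UNIV_iff)
  next
    fix \<phi> assume "\<phi> \<in> ?W"
    then have "(\<Sum>(i, j)\<in>I \<times> I. block i j \<phi>) = \<phi>"
      using sum_block by (simp add: quasi_centroid_UNIV_iff flip: sum.cartesian_product)
    then show "(\<Sum>a\<in>?J. block (fst (D a)) (snd (D a)) \<phi>) = \<phi>"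
      using sum.reindex_bij_betw[OF bij, of "\<lambda>(i, j). block i j \<phi>"]
      by (simp add: case_prod_beta)
  next
    fix x assume x: "x \<in> (\<Pi>\<^sub>E a\<in>?J. ?V a)"
    have x_mem: "x a \<in> peirce (fst (D a)) (snd (D a))" if "a \<in> ?J" for a
      using PiE_mem[OF x that] unfolding V .
    then show "(\<Sum>a\<in>?J. x a) \<in> ?W"
      by (intro F.subspace_sum[OF subspace_quasi_centroid]) (auto simp: peirce_def)
    fix a assume a: "a \<in> ?J"
    \<comment> \<open>Since \<open>D\<close> is injective, different indices occupy different
      positions, and orthogonality of the blocks removes all terms but the one at
      \<open>a\<close>.\<close>
    have "block (fst (D a)) (snd (D a)) (x b) = (if b = a then x a else 0)" if b: "b \<in> ?J" for b
    proof -
      have "block (fst (D b)) (snd (D b)) (x b) = x b" "Vector_Spaces.linear scale scale (x b)"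
        using x_mem[OF b] by (auto simp: peirce_def quasi_centroid_UNIV_iff)
      moreover have "D a = D b \<longleftrightarrow> a = b"
        using bij a b by (auto simp: bij_betw_def dest: inj_onD)
      ultimately show ?thesis
        using block_block[of "x b" "fst (D a)" "snd (D a)" "fst (D b)" "snd (D b)"]
          D_mem[OF a] D_mem[OF b] by (auto simp: prod_eq_iff)
    qed
    then show "block (fst (D a)) (snd (D a)) (\<Sum>b\<in>?J. x b) = x a"
      using a D_mem[OF a] fin by (simp add: block_sum)
  qed
qed

section \<open>Peirce components as extensions by zero\<close>

lemma peirce_restrict:
  assumes "\<psi> \<in> peirce i j" "i \<in> I" "j \<in> I"
  shows "extend_by_zero I Z i (restrict \<psi> (Z i)) = \<psi>"
    and "restrict \<psi> (Z i) \<in> hom_space scale (Z i) (Z j)"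
proof -
  have \<psi>: "pr j (\<psi> (pr i z)) = \<psi> z" for z
    using assms(1) by (simp add: peirce_def block_def fun_eq_iff)
  \<comment> \<open>Evaluating the fixed-point equation at \<open>pr i z\<close> changes nothing, as
    \<open>pr i\<close> is idempotent. Hence \<psi> sees only the component in \<open>Z i\<close>,
    and restricting it there loses no information.\<close>
  have "\<psi> (pr i z) = \<psi> z" for z
    using \<psi>[of "pr i z"] \<psi>[of z] assms(2) by (simp add: pr_pr)
  then show "extend_by_zero I Z i (restrict \<psi> (Z i)) = \<psi>"
    using pr_mem[OF assms(2)] by (simp add: extend_by_zero_def fun_eq_iff)
  have "\<psi> z \<in> Z j" for z
    using pr_mem[OF assms(3)] \<psi> by metis
  moreover have "Vector_Spaces.linear scale scale \<psi>"
    using assms(1) by (simp add: peirce_def quasi_centroid_UNIV_iff)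
  ultimately show "restrict \<psi> (Z i) \<in> hom_space scale (Z i) (Z j)"
    using subspace_summand[OF assms(2)]
    by (auto simp: hom_space_def Vector_Spaces.linear_iff subspace_add subspace_scale)
qed

text \<open>This serves diagonal and off-diagonal components alike. The last hypothesis is the
  quasi-centroid identity of the extended map, whose value at \<open>z\<close> is
  \<open>\<phi> (pr i z)\<close>.\<close>

lemma extend_by_zero_peirce:
  assumes "i \<in> I" "j \<in> I" "\<phi> \<in> hom_space scale (Z i) (Z j)"
    and "\<And>p q. \<phi> (pr i p) \<cdot> q = p \<cdot> \<phi> (pr i q)"
  shows "extend_by_zero I Z i \<phi> \<in> peirce i j"
proof -
  have "\<phi> (pr i z) \<in> Z j" for z
    using assms(3) pr_mem[OF assms(1)] by (auto simp: hom_space_def)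
  then have "block i j (extend_by_zero I Z i \<phi>) = extend_by_zero I Z i \<phi>"
    using assms(1,2) by (auto simp: block_def extend_by_zero_def fun_eq_iff pr_pr pr_summand)
  then show ?thesis
    using extend_by_zero_linear[OF vector_space_axioms direct_sum assms(1,3)] assms(4)
    by (simp add: peirce_def quasi_centroid_UNIV_iff extend_by_zero_def)
qed

lemma extend_by_zero_quasi_centroid:
  assumes "i \<in> I"
  shows "extend_by_zero I Z i ` quasi_centroid scale mult (Z i) = peirce i i"
proof
  show "extend_by_zero I Z i ` quasi_centroid scale mult (Z i) \<subseteq> peirce i i"
  proof (rule image_subsetI)
    fix \<phi> assume \<phi>: "\<phi> \<in> quasi_centroid scale mult (Z i)"
    then have mem: "\<phi> (pr i z) \<in> Z i" for z
      using pr_mem[OF assms] by (auto simp: quasi_centroid_def hom_space_def)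
    \<comment> \<open>Multiplication by an element of \<open>Z i\<close> sees only the component in
      \<open>Z i\<close>, so \<open>p\<close> and \<open>q\<close> may be projected first; the
      identity on \<open>Z i\<close> then applies.\<close>
    have "\<phi> (pr i p) \<cdot> q = p \<cdot> \<phi> (pr i q)" for p q
      using \<phi> mult_pr_right[OF assms mem, of p q] mult_pr_left[OF assms mem, of p q] pr_mem[OF assms]
      by (auto simp: quasi_centroid_def)
    then show "extend_by_zero I Z i \<phi> \<in> peirce i i"
      using assms \<phi> by (intro extend_by_zero_peirce) (auto simp: quasi_centroid_def)
  qed
  show "peirce i i \<subseteq> extend_by_zero I Z i ` quasi_centroid scale mult (Z i)"
  proof
    fix \<psi> assume \<psi>: "\<psi> \<in> peirce i i"
    have "restrict \<psi> (Z i) \<in> quasi_centroid scale mult (Z i)"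
      using \<psi> peirce_restrict(2)[OF \<psi> assms assms]
      by (auto simp: quasi_centroid_def peirce_def)
    then show "\<psi> \<in> extend_by_zero I Z i ` quasi_centroid scale mult (Z i)"
      using peirce_restrict(1)[OF \<psi> assms assms] by (metis imageI)
  qed
qed

lemma extend_by_zero_center_hom:
  assumes "i \<in> I" "j \<in> I" "i \<noteq> j"
  shows "extend_by_zero I Z i ` center_hom scale mult Z i j = peirce i j"
proof
  show "extend_by_zero I Z i ` center_hom scale mult Z i j \<subseteq> peirce i j"
  proof (rule image_subsetI)
    fix \<phi> assume \<phi>: "\<phi> \<in> center_hom scale mult Z i j"
    have center: "\<phi> (pr i z) \<in> center mult (Z j)" for z
      using \<phi> pr_mem[OF assms(1)] by (auto simp: center_hom_def)
    \<comment> \<open>Elements of the center of \<open>Z j\<close> annihilate the whole space,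
      because products with them depend only on the component in \<open>Z j\<close>. The
      quasi-centroid identity thus reduces to 0 = 0.\<close>
    have "\<phi> (pr i p) \<cdot> q = 0" "p \<cdot> \<phi> (pr i q) = 0" for p q
      using center[of p] center[of q] pr_mem[OF assms(2)]
        mult_pr_right[OF assms(2), of "\<phi> (pr i p)" q] mult_pr_left[OF assms(2), of "\<phi> (pr i q)" p]
      by (auto simp: center_def)
    then show "extend_by_zero I Z i \<phi> \<in> peirce i j"
      using assms \<phi> by (intro extend_by_zero_peirce) (auto simp: center_hom_def)
  qed
  show "peirce i j \<subseteq> extend_by_zero I Z i ` center_hom scale mult Z i j"
  proof
    fix \<psi> assume \<psi>: "\<psi> \<in> peirce i j"
    then have Q: "\<psi> \<in> quasi_centroid scale mult UNIV"
      by (simp add: peirce_def)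
    have hom: "restrict \<psi> (Z i) \<in> hom_space scale (Z i) (Z j)"
      by (rule peirce_restrict(2)[OF \<psi> assms(1,2)])
    \<comment> \<open>The second product equals \<open>\<psi> q \<cdot> p\<close>, which vanishes by
      the off-diagonal argument with \<open>i\<close> and \<open>j\<close> exchanged.\<close>
    have "\<psi> p \<cdot> q = 0" "q \<cdot> \<psi> p = 0" if "p \<in> Z i" "q \<in> Z j" for p q
      using quasi_centroid_off_diagonal[OF Q] quasi_centroid_swap[OF Q, of q p] assms that
      by metis+
    then have "restrict \<psi> (Z i) \<in> center_hom scale mult Z i j"
      using hom assms(3) by (auto simp: center_hom_def center_def hom_space_def)
    then show "\<psi> \<in> extend_by_zero I Z i ` center_hom scale mult Z i j"
      using peirce_restrict(1)[OF \<psi> assms(1,2)] by (metis imageI)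
  qed
qed

section \<open>Assembly of the decomposition\<close>

lemma direct_sum_quasi_centroid:
  "internal_direct_sum (fun_scale scale) (I <+> {(i, j). i \<in> I \<and> j \<in> I \<and> i \<noteq> j})
     (case_sum
       (\<lambda>i. extend_by_zero I Z i ` quasi_centroid scale mult (Z i))
       (\<lambda>(i, j). extend_by_zero I Z i ` center_hom scale mult Z i j))
     (quasi_centroid scale mult UNIV)"
  by (rule internal_direct_sum_cong[THEN iffD2, OF _ direct_sum_peirce])
    (elim PlusE; clarsimp simp: extend_by_zero_quasi_centroid extend_by_zero_center_hom)

end

theorem corollary3p14:
  fixes scale :: "'k::field \<Rightarrow> 'v::ab_group_add \<Rightarrow> 'v"
    and mult :: "'v \<Rightarrow> 'v \<Rightarrow> 'v"
    and Z :: "nat \<Rightarrow> 'v set"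
    and m :: nat
  assumes "zinbiel_algebra scale mult"
    and "\<And>i. i \<in> {1..m} \<Longrightarrow> zinbiel_ideal scale mult (Z i)"
    and "internal_direct_sum scale {1..m} Z UNIV"
  shows "internal_direct_sum (fun_scale scale)
           ({1..m} <+> {(i, j). i \<in> {1..m} \<and> j \<in> {1..m} \<and> i \<noteq> j})
           (case_sum
             (\<lambda>i. extend_by_zero {1..m} Z i ` quasi_centroid scale mult (Z i))
             (\<lambda>(i, j). extend_by_zero {1..m} Z i ` center_hom scale mult Z i j))
           (quasi_centroid scale mult UNIV)"
proof -
  interpret zinbiel_ideal_decomposition scale mult "{1..m}" Z
    using assms by (simp add: zinbiel_ideal_decomposition_def zinbiel_ideal_decomposition_axioms_def)
  show ?thesis
    by (rule direct_sum_quasi_centroid)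
qed

end
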